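(* If $(P,\le)$ is a better partial order (BPO), then so is $(P^\#,<<)$, the set of finite multisets of $P$ ordered by the multiset projectivity relation.
   Context: Identify each subset of $\omega$ with its increasing enumeration; for $s\in[\omega]^{<\omega}$ (finite subsets) and $B\subseteq\omega$, write $s\sqsubseteq B$ if $s$ is an initial segment of $B$. For $A\in[\omega]^\omega$ (infinite subsets), a front on $A$ is a set $F\subseteq[\omega]^{<\omega}$ such that: (i) either $F=\{\emptyset\}$ or $\bigcup F=A$; (ii) for $s,t\in F$, $s\sqsubseteq t$ implies $s=t$; (iii) for every infinite $B\subseteq A$ there is a unique $s\in F$ with $s\sqsubseteq B$. For $s,t\in[\omega]^{<\omega}$, $s\lhd t$ means there is an infinite $B\subseteq\omega$ with $s\sqsubseteq B$ and $t\sqsubseteq B\setminus\{\min B\}$. A super-sequence in a poset $(Q,\le)$ is a map $f\colon F\to Q$ from a front $F$; it is bad if $s\lhd t$ implies $f(s)\not\le f(t)$ for all $s,t\in F$. A poset is a better partial order (BPO) if it admits no bad super-sequence. A finite multiset of $P$ is a map $M\colon B\to\omega\setminus\{0\}$ with $B\subseteq P$ finite ($M(b)$ = number of occurrences of $b$); $P^\#$ is the set of finite multisets. A map $f\colon M\to N$ of multisets assigns to each occurrence in $M$ one occurrence in $N$; it is surjective if every occurrence in $N$ is hit. $N<<M$ iff there is a surjective map $f\colon M\to N$ with $f(p)\le p$ for all $p\in M$. *)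

theory Defs
  imports "HOL-Library.Multiset" "HOL-Library.FuncSet"
begin

(* Subsets of omega are sets of natural numbers. Under the identification of a set with its
   increasing enumeration, s is an initial segment of B iff s is a subset of B that is closed
   downwards in B. In particular the empty set is an initial segment of every set. *)
definition init_seg :: "nat set \<Rightarrow> nat set \<Rightarrow> bool" (infix \<open>\<sqsubseteq>\<^sub>i\<close> 50) where
  "s \<sqsubseteq>\<^sub>i B \<longleftrightarrow> s \<subseteq> B \<and> (\<forall>x\<in>s. \<forall>b\<in>B. b < x \<longrightarrow> b \<in> s)"

definition front_on :: "nat set \<Rightarrow> nat set set \<Rightarrow> bool" where
  "front_on A F \<longleftrightarrow>
     infinite A \<and> (\<forall>s\<in>F. finite s) \<and>
     (F = {{}} \<or> \<Union>F = A) \<and>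
     (\<forall>s\<in>F. \<forall>t\<in>F. s \<sqsubseteq>\<^sub>i t \<longrightarrow> s = t) \<and>
     (\<forall>B. infinite B \<and> B \<subseteq> A \<longrightarrow> (\<exists>!s. s \<in> F \<and> s \<sqsubseteq>\<^sub>i B))"

definition front :: "nat set set \<Rightarrow> bool" where
  "front F \<longleftrightarrow> (\<exists>A. front_on A F)"

(* The library's Min is meaningful only for finite sets, hence LEAST. *)
definition shift_rel :: "nat set \<Rightarrow> nat set \<Rightarrow> bool" (infix \<open>\<lhd>\<^sub>s\<close> 50) where
  "s \<lhd>\<^sub>s t \<longleftrightarrow> (\<exists>B. infinite B \<and> s \<sqsubseteq>\<^sub>i B \<and> t \<sqsubseteq>\<^sub>i B - {LEAST n. n \<in> B})"

(* A poset is a carrier set Q with a relation r satisfying partial_order_on Q r;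
   (x, y) \<in> r means that x is below or equal to y. *)
definition super_sequence :: "'a set \<Rightarrow> nat set set \<Rightarrow> (nat set \<Rightarrow> 'a) \<Rightarrow> bool" where
  "super_sequence Q F f \<longleftrightarrow> front F \<and> f \<in> F \<rightarrow> Q"

definition bad :: "'a rel \<Rightarrow> nat set set \<Rightarrow> (nat set \<Rightarrow> 'a) \<Rightarrow> bool" where
  "bad r F f \<longleftrightarrow> (\<forall>s\<in>F. \<forall>t\<in>F. s \<lhd>\<^sub>s t \<longrightarrow> (f s, f t) \<notin> r)"

definition bpo :: "'a set \<Rightarrow> 'a rel \<Rightarrow> bool" where
  "bpo Q r \<longleftrightarrow> partial_order_on Q r \<and> \<not> (\<exists>F f. super_sequence Q F f \<and> bad r F f)"

definition multisets_over :: "'a set \<Rightarrow> 'a multiset set" where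
  "multisets_over P = {M. set_mset M \<subseteq> P}"

(* The pair (b, i) with i < count M b stands for the i-th occurrence of b in M. *)
definition occurrences :: "'a multiset \<Rightarrow> ('a \<times> nat) set" where
  "occurrences M = (SIGMA b:set_mset M. {..<count M b})"

(* (N, M) \<in> mset_proj P r is N << M: the map goes from M onto N and takes each occurrence to an
   occurrence of an element below it. *)
definition mset_proj :: "'a set \<Rightarrow> 'a rel \<Rightarrow> 'a multiset rel" where
  "mset_proj P r =
     {(N, M). N \<in> multisets_over P \<and> M \<in> multisets_over P \<and>
        (\<exists>f. f ` occurrences M = occurrences N \<and>
             (\<forall>p\<in>occurrences M. (fst (f p), fst p) \<in> r))}"

end

theory Submission
  imports Defs "HOL-Library.Infinite_Set"
begin

text \<open>
  Super-sequences correspond to locally constant maps \<open>g\<close> on the infinite subsets of a fixed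
  infinite set, badness meaning that \<open>g B\<close> is never below \<open>g B'\<close>, where \<open>B'\<close> is \<open>B\<close> without
  its minimum. In one direction, the minimal finite sets that decide the value of \<open>g\<close> form a front.

  If \<open>P\<close> is BPO and \<open>S\<close> is a locally constant map into the subsets of \<open>P\<close>, then after shrinking the
  base set every element of \<open>S B'\<close> lies above some element of \<open>S B\<close>: otherwise a Ramsey argument
  lets one pick, for all \<open>B\<close>, an element of \<open>S B'\<close> above nothing in \<open>S B\<close>, and the picks form a bad
  array in \<open>P\<close>.

  Now let \<open>g\<close> be a bad array of multisets. By the above applied to the supports of \<open>g B\<close>, the only
  obstruction to \<open>g B << g B'\<close> is the lack of an increasing injection of \<open>g B\<close> into \<open>g B'\<close>, so Hall's theorem
  gives a set \<open>X B\<close> of occurrences in \<open>g B\<close> with fewer than \<open>|X B|\<close> occurrences of \<open>g B'\<close> above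
  it. By the same principle applied to \<open>X\<close>, all of \<open>X B'\<close> lies above \<open>X B\<close>, whence
  \<open>|X B'| < |X B|\<close> for all \<open>B\<close>, an infinite descent.
\<close>

section \<open>Locally constant arrays\<close>

text \<open>This is continuity on the space of infinite subsets of \<open>A\<close>, with discrete
  values. The cutoff \<open>n\<close> may depend on \<open>B\<close>.\<close>

definition locally_constant :: "nat set \<Rightarrow> (nat set \<Rightarrow> 'b) \<Rightarrow> bool" where
  "locally_constant A g \<longleftrightarrow>
     (\<forall>B. infinite B \<and> B \<subseteq> A \<longrightarrow>
        (\<exists>n. \<forall>C. infinite C \<and> C \<subseteq> A \<and> C \<inter> {..<n} = B \<inter> {..<n} \<longrightarrow> g C = g B))"

definition behead :: "nat set \<Rightarrow> nat set" where
  "behead B = B - {LEAST n. n \<in> B}"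

lemma infinite_behead [simp]: "infinite (behead B) \<longleftrightarrow> infinite B"
  by (simp add: behead_def)

lemma behead_subset: "behead B \<subseteq> B"
  by (auto simp: behead_def)

lemma least_less_behead: "x \<in> behead B \<Longrightarrow> (LEAST n. n \<in> B) < x"
  by (metis (mono_tags, lifting) DiffE Least_le behead_def insertI1 nat_less_le)

lemma insert_least_behead: "B \<noteq> {} \<Longrightarrow> insert (LEAST n. n \<in> B) (behead B) = B"
  by (metis LeastI behead_def ex_in_conv insert_Diff)

lemma locally_constantD:
  assumes "locally_constant A g" "infinite B" "B \<subseteq> A"
  obtains n where
    "\<And>C. infinite C \<Longrightarrow> C \<subseteq> A \<Longrightarrow> C \<inter> {..<n} = B \<inter> {..<n} \<Longrightarrow> g C = g B"
proof -
  have "\<exists>n. \<forall>C. infinite C \<and> C \<subseteq> A \<and> C \<inter> {..<n} = B \<inter> {..<n} \<longrightarrow> g C = g B"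
    using assms unfolding locally_constant_def by simp
  then show ?thesis using that by auto
qed

lemma locally_constant_subset:
  assumes "locally_constant A g" "A' \<subseteq> A"
  shows "locally_constant A' g"
  unfolding locally_constant_def
proof (intro allI impI, elim conjE)
  fix B assume B: "infinite B" "B \<subseteq> A'"
  then obtain n where "\<And>C. infinite C \<Longrightarrow> C \<subseteq> A \<Longrightarrow> C \<inter> {..<n} = B \<inter> {..<n} \<Longrightarrow> g C = g B"
    using locally_constantD[OF assms(1), of B] assms(2) by (metis subset_trans)
  then show "\<exists>n. \<forall>C. infinite C \<and> C \<subseteq> A' \<and> C \<inter> {..<n} = B \<inter> {..<n} \<longrightarrow> g C = g B"
    using assms(2) by (intro exI[of _ n]) auto
qed

lemma locally_constant_compose: "locally_constant A g \<Longrightarrow> locally_constant A (\<lambda>B. h (g B))"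
  unfolding locally_constant_def by metis

lemma cutoff_mono:
  fixes B C :: "nat set"
  assumes "C \<inter> {..<m} = B \<inter> {..<m}" "n \<le> m"
  shows "C \<inter> {..<n} = B \<inter> {..<n}"
proof -
  have "{..<n} = {..<m} \<inter> {..<n}" using assms(2) by auto
  then show ?thesis using assms(1) by (metis Int_assoc)
qed

lemma locally_constant_Pair:
  assumes "locally_constant A g" "locally_constant A h"
  shows "locally_constant A (\<lambda>B. (g B, h B))"
  unfolding locally_constant_def
proof (intro allI impI, elim conjE)
  fix B assume B: "infinite B" "B \<subseteq> A"
  obtain m where m: "\<And>C. infinite C \<Longrightarrow> C \<subseteq> A \<Longrightarrow> C \<inter> {..<m} = B \<inter> {..<m} \<Longrightarrow> g C = g B"
    using locally_constantD[OF assms(1) B] by metis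
  obtain n where n: "\<And>C. infinite C \<Longrightarrow> C \<subseteq> A \<Longrightarrow> C \<inter> {..<n} = B \<inter> {..<n} \<Longrightarrow> h C = h B"
    using locally_constantD[OF assms(2) B] by metis
  have "(g C, h C) = (g B, h B)"
    if "infinite C" "C \<subseteq> A" "C \<inter> {..<max m n} = B \<inter> {..<max m n}" for C
    using m[of C] n[of C] that cutoff_mono[OF that(3), of m] cutoff_mono[OF that(3), of n] by simp
  then show "\<exists>k. \<forall>C. infinite C \<and> C \<subseteq> A \<and> C \<inter> {..<k} = B \<inter> {..<k}
      \<longrightarrow> (g C, h C) = (g B, h B)"
    by blast
qed

text \<open>A cutoff beyond the minimum of \<open>B\<close> forces \<open>C\<close> to have the same
  minimum, so both sets lose the same element.\<close>

lemma behead_cutoff: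
  assumes "C \<inter> {..<n} = B \<inter> {..<n}" "B \<noteq> {}" "(LEAST k. k \<in> B) < n"
  shows "behead C \<inter> {..<n} = behead B \<inter> {..<n}"
proof -
  let ?m = "LEAST k. k \<in> B"
  have "?m \<in> B" using assms(2) by (metis LeastI ex_in_conv)
  then have "?m \<in> C" using assms by blast
  moreover have "?m \<le> k" if "k \<in> C" for k
  proof (cases "k < n")
    case True
    then have "k \<in> B" using that assms(1) by blast
    then show ?thesis by (rule Least_le)
  next
    case False
    then show ?thesis using assms(3) by simp
  qed
  ultimately have "(LEAST k. k \<in> C) = ?m"
    by (rule Least_equality)
  then show ?thesis
    using assms(1) unfolding behead_def by auto
qed

lemma locally_constant_behead:
  assumes "locally_constant A g"
  shows "locally_constant A (\<lambda>B. g (behead B))"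
  unfolding locally_constant_def
proof (intro allI impI, elim conjE)
  fix B assume B: "infinite B" "B \<subseteq> A"
  then have "infinite (behead B)" "behead B \<subseteq> A"
    using behead_subset[of B] by auto
  then obtain n where n: "\<And>C. infinite C \<Longrightarrow> C \<subseteq> A \<Longrightarrow>
      C \<inter> {..<n} = behead B \<inter> {..<n} \<Longrightarrow> g C = g (behead B)"
    using locally_constantD[OF assms] by metis
  define k where "k = max n (Suc (LEAST k. k \<in> B))"
  have "g (behead C) = g (behead B)"
    if C: "infinite C" "C \<subseteq> A" "C \<inter> {..<k} = B \<inter> {..<k}" for C
  proof (rule n)
    show "infinite (behead C)" "behead C \<subseteq> A"
      using C behead_subset[of C] by auto
    have "behead C \<inter> {..<k} = behead B \<inter> {..<k}"
      using C(3) B(1) by (intro behead_cutoff) (auto simp: k_def)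
    then show "behead C \<inter> {..<n} = behead B \<inter> {..<n}"
      by (rule cutoff_mono) (simp add: k_def)
  qed
  then show "\<exists>n. \<forall>C. infinite C \<and> C \<subseteq> A \<and> C \<inter> {..<n} = B \<inter> {..<n}
      \<longrightarrow> g (behead C) = g (behead B)"
    by blast
qed

text \<open>Selections made later by \<open>SOME\<close> depend on \<open>B\<close> only through
  \<open>g B\<close> and \<open>g (behead B)\<close>; taking the selection as \<open>h\<close> makes
  them locally constant.\<close>

lemma locally_constant_step:
  assumes "locally_constant A g"
  shows "locally_constant A (\<lambda>B. h (g B) (g (behead B)))"
proof -
  have "locally_constant A (\<lambda>B. case_prod h (g B, g (behead B)))"
    by (rule locally_constant_compose
        [OF locally_constant_Pair[OF assms locally_constant_behead[OF assms]]])
  then show ?thesis by simp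
qed

section \<open>Fronts and locally constant arrays\<close>

lemma init_seg_cutoff: "B \<inter> {..<n} \<sqsubseteq>\<^sub>i B"
  by (auto simp: init_seg_def)

lemma init_seg_refl: "s \<sqsubseteq>\<^sub>i s"
  by (simp add: init_seg_def)

lemma init_seg_empty: "{} \<sqsubseteq>\<^sub>i s"
  by (simp add: init_seg_def)

lemma init_seg_trans: "s \<sqsubseteq>\<^sub>i t \<Longrightarrow> t \<sqsubseteq>\<^sub>i B \<Longrightarrow> s \<sqsubseteq>\<^sub>i B"
  unfolding init_seg_def by blast

lemma init_seg_linear:
  assumes "s \<sqsubseteq>\<^sub>i B" "t \<sqsubseteq>\<^sub>i B"
  shows "s \<sqsubseteq>\<^sub>i t \<or> t \<sqsubseteq>\<^sub>i s"
proof -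
  have "s \<subseteq> t \<or> t \<subseteq> s"
  proof (rule disjCI, rule subsetI)
    fix x assume "\<not> t \<subseteq> s" and x: "x \<in> s"
    then obtain y where y: "y \<in> t" "y \<notin> s" by blast
    then have "\<not> y < x" using assms x unfolding init_seg_def by blast
    moreover have "y \<noteq> x" using x y by blast
    ultimately show "x \<in> t"
      using assms x y unfolding init_seg_def by (meson nat_neq_iff subsetD)
  qed
  then show ?thesis
    using assms unfolding init_seg_def by blast
qed

text \<open>The cut \<open>m\<close> is the least element of \<open>B\<close> outside
  \<open>s\<close>, which exists because \<open>s\<close> is finite and \<open>B\<close> is
  not.\<close>

lemma init_seg_eq_cutoff:
  assumes "s \<sqsubseteq>\<^sub>i B" "finite s" "infinite B"
  obtains m where "m \<in> B" "s = B \<inter> {..<m}" "\<And>x. x \<in> s \<Longrightarrow> x < m"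
proof -
  define m where "m = (LEAST m. m \<in> B - s)"
  have "B - s \<noteq> {}" using assms by (metis Diff_eq_empty_iff finite_subset)
  then have m: "m \<in> B - s" unfolding m_def by (metis LeastI ex_in_conv)
  have "x < m" if "x \<in> s" for x
    using m that assms(1) unfolding init_seg_def by (metis Diff_iff linorder_neqE_nat)
  moreover have "x \<in> s" if "x \<in> B" "x < m" for x
    using that not_less_Least[of x "\<lambda>m. m \<in> B - s"] unfolding m_def by auto
  ultimately show ?thesis
    using m assms(1) by (intro that[of m]) (auto simp: init_seg_def)
qed

lemma front_on_unique:
  "front_on A F \<Longrightarrow> infinite B \<Longrightarrow> B \<subseteq> A \<Longrightarrow> \<exists>!s. s \<in> F \<and> s \<sqsubseteq>\<^sub>i B"
  by (simp add: front_on_def)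

text \<open>The front element of \<open>B\<close> is a cut of \<open>B\<close> at some
  \<open>m\<close>, so every set agreeing with \<open>B\<close> below \<open>m\<close> has the same
  front element.\<close>

lemma locally_constant_front_array:
  assumes "front_on A F"
  shows "locally_constant A (\<lambda>B. f (THE s. s \<in> F \<and> s \<sqsubseteq>\<^sub>i B))"
  unfolding locally_constant_def
proof (intro allI impI, elim conjE)
  fix B assume B: "infinite B" "B \<subseteq> A"
  note uniq = front_on_unique[OF assms]
  obtain s where s: "s \<in> F" "s \<sqsubseteq>\<^sub>i B" using uniq[OF B] by blast
  then have "finite s" using assms by (simp add: front_on_def)
  then obtain m where m: "s = B \<inter> {..<m}"
    using init_seg_eq_cutoff[OF s(2) _ B(1)] by metis
  have "(THE s. s \<in> F \<and> s \<sqsubseteq>\<^sub>i C) = (THE s. s \<in> F \<and> s \<sqsubseteq>\<^sub>i B)"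
    if C: "infinite C" "C \<subseteq> A" "C \<inter> {..<m} = B \<inter> {..<m}" for C
  proof -
    have "s \<sqsubseteq>\<^sub>i C" using C(3) m init_seg_cutoff[of C m] by simp
    then have "(THE s. s \<in> F \<and> s \<sqsubseteq>\<^sub>i C) = s"
      using s(1) uniq[OF C(1,2)] by (intro the1_equality) auto
    moreover have "(THE s. s \<in> F \<and> s \<sqsubseteq>\<^sub>i B) = s"
      using s uniq[OF B] by (intro the1_equality) auto
    ultimately show ?thesis by simp
  qed
  then have "f (THE s. s \<in> F \<and> s \<sqsubseteq>\<^sub>i C) = f (THE s. s \<in> F \<and> s \<sqsubseteq>\<^sub>i B)"
    if "infinite C" "C \<subseteq> A" "C \<inter> {..<m} = B \<inter> {..<m}" for C
    using that by simp
  then show "\<exists>n. \<forall>C. infinite C \<and> C \<subseteq> A \<and> C \<inter> {..<n} = B \<inter> {..<n} \<longrightarrow>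
      f (THE s. s \<in> F \<and> s \<sqsubseteq>\<^sub>i C) = f (THE s. s \<in> F \<and> s \<sqsubseteq>\<^sub>i B)"
    by blast
qed

section \<open>Fronts of minimal deciding sets\<close>

definition decides :: "nat set \<Rightarrow> (nat set \<Rightarrow> 'b) \<Rightarrow> nat set \<Rightarrow> bool" where
  "decides A g s \<longleftrightarrow>
     (\<forall>C D. infinite C \<and> C \<subseteq> A \<and> s \<sqsubseteq>\<^sub>i C \<and> infinite D \<and> D \<subseteq> A \<and> s \<sqsubseteq>\<^sub>i D \<longrightarrow> g C = g D)"

text \<open>For infinite \<open>A\<close>, requiring \<open>s \<subseteq> A\<close> keeps out sets
  that decide only vacuously, having no infinite extension inside \<open>A\<close>.\<close>

definition deciding_front :: "nat set \<Rightarrow> (nat set \<Rightarrow> 'b) \<Rightarrow> nat set set" where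
  "deciding_front A g =
     {s. finite s \<and> s \<subseteq> A \<and> decides A g s \<and> (\<forall>t. t \<sqsubseteq>\<^sub>i s \<and> decides A g t \<longrightarrow> t = s)}"

lemma deciding_front_antichain:
  "s \<in> deciding_front A g \<Longrightarrow> t \<in> deciding_front A g \<Longrightarrow> s \<sqsubseteq>\<^sub>i t \<Longrightarrow> s = t"
  unfolding deciding_front_def by blast

lemma deciding_front_exists:
  assumes g: "locally_constant A g" and B: "infinite B" "B \<subseteq> A"
  shows "\<exists>s. s \<in> deciding_front A g \<and> s \<sqsubseteq>\<^sub>i B"
proof -
  obtain n where n: "\<And>C. infinite C \<Longrightarrow> C \<subseteq> A \<Longrightarrow> C \<inter> {..<n} = B \<inter> {..<n} \<Longrightarrow> g C = g B"
    using locally_constantD[OF g B] by metis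
  obtain m where m: "m \<in> B" "n \<le> m"
    using B(1) by (auto simp: infinite_nat_iff_unbounded_le)
  \<comment> \<open>The segment must end with an element \<open>m \<ge> n\<close> of
    \<open>B\<close>: an extension of \<open>B \<inter> {..<n}\<close> might contain further numbers
    below \<open>n\<close>, whereas an extension of \<open>?s\<close> agrees with \<open>B\<close>
    up to \<open>m\<close>.\<close>
  let ?s = "B \<inter> {..m}"
  have s: "?s \<sqsubseteq>\<^sub>i B" by (auto simp: init_seg_def)
  have "g C = g B" if "infinite C" "C \<subseteq> A" "?s \<sqsubseteq>\<^sub>i C" for C
  proof (rule n[OF that(1,2)])
    show "C \<inter> {..<n} = B \<inter> {..<n}"
    proof (intro set_eqI iffI)
      fix x assume "x \<in> C \<inter> {..<n}"
      then have "x \<in> C" "x < n" by auto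
      moreover have "m \<in> ?s" using m by simp
      ultimately have "x \<in> ?s"
        using that(3) m(2) unfolding init_seg_def by (meson less_le_trans)
      then show "x \<in> B \<inter> {..<n}" using \<open>x < n\<close> by simp
    next
      fix x assume "x \<in> B \<inter> {..<n}"
      then have "x \<in> ?s" using m(2) by auto
      then show "x \<in> C \<inter> {..<n}"
        using that(3) \<open>x \<in> B \<inter> {..<n}\<close> unfolding init_seg_def by blast
    qed
  qed
  then have "decides A g ?s" unfolding decides_def by metis
  then have ex: "\<exists>s. finite s \<and> s \<sqsubseteq>\<^sub>i B \<and> decides A g s"
    using s by blast
  \<comment> \<open>A deciding initial segment of least size has no proper deciding initial segment,
    since that would again be an initial segment of \<open>B\<close>.\<close>
  define s where "s = arg_min card (\<lambda>s. finite s \<and> s \<sqsubseteq>\<^sub>i B \<and> decides A g s)"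
  have s: "finite s" "s \<sqsubseteq>\<^sub>i B" "decides A g s"
    and least: "\<And>t. finite t \<and> t \<sqsubseteq>\<^sub>i B \<and> decides A g t \<Longrightarrow> card s \<le> card t"
    using arg_min_natI[of "\<lambda>s. finite s \<and> s \<sqsubseteq>\<^sub>i B \<and> decides A g s", of _ card]
      arg_min_nat_le[of "\<lambda>s. finite s \<and> s \<sqsubseteq>\<^sub>i B \<and> decides A g s" _ card] ex
    unfolding s_def by blast+
  have "t = s" if t: "t \<sqsubseteq>\<^sub>i s" "decides A g t" for t
  proof -
    have "t \<subseteq> s" using t(1) unfolding init_seg_def by simp
    moreover have "card s \<le> card t"
      using least t init_seg_trans[OF t(1) s(2)] s(1) \<open>t \<subseteq> s\<close> finite_subset by blast
    ultimately show ?thesis using s(1) by (simp add: card_seteq)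
  qed
  moreover have "s \<subseteq> A" using s(2) B(2) unfolding init_seg_def by blast
  ultimately show ?thesis
    using s unfolding deciding_front_def by blast
qed

lemma front_on_deciding_front:
  assumes A: "infinite A" and g: "locally_constant A g"
  shows "front_on A (deciding_front A g)"
proof -
  let ?F = "deciding_front A g"
  have "\<exists>!s. s \<in> ?F \<and> s \<sqsubseteq>\<^sub>i B" if "infinite B" "B \<subseteq> A" for B
  proof (rule ex_ex1I)
    show "\<exists>s. s \<in> ?F \<and> s \<sqsubseteq>\<^sub>i B"
      using deciding_front_exists[OF g that] .
    show "s = t" if "s \<in> ?F \<and> s \<sqsubseteq>\<^sub>i B" "t \<in> ?F \<and> t \<sqsubseteq>\<^sub>i B" for s t
      using that init_seg_linear[of s B t] deciding_front_antichain[of s A g t]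
        deciding_front_antichain[of t A g s] by blast
  qed
  moreover have "?F = {{}} \<or> \<Union>?F = A"
  proof (cases "{} \<in> ?F")
    case True
    moreover have "s = {}" if "s \<in> ?F" for s
      using deciding_front_antichain[OF True that init_seg_empty] by simp
    ultimately show ?thesis by blast
  next
    case False
    have "a \<in> \<Union>?F" if a: "a \<in> A" for a
    proof -
      \<comment> \<open>This set has minimum \<open>a\<close>, so its nonempty initial segments
        contain \<open>a\<close>.\<close>
      let ?B = "A \<inter> {a..}"
      have "infinite ?B"
        using A by (metis Diff_Compl Diff_infinite_finite Compl_atLeast finite_lessThan)
      then obtain s where s: "s \<in> ?F" "s \<sqsubseteq>\<^sub>i ?B"
        using deciding_front_exists[OF g] by (metis inf_le1)
      then obtain x where "x \<in> s" using False by (metis ex_in_conv)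
      then have "a \<in> s" using s(2) a unfolding init_seg_def
        by (metis Int_iff atLeast_iff le_neq_implies_less order_refl subset_iff)
      then show ?thesis using s(1) by blast
    qed
    then show ?thesis unfolding deciding_front_def by blast
  qed
  moreover have "\<forall>s\<in>?F. finite s" unfolding deciding_front_def by simp
  moreover have "\<forall>s\<in>?F. \<forall>t\<in>?F. s \<sqsubseteq>\<^sub>i t \<longrightarrow> s = t"
    using deciding_front_antichain by blast
  ultimately show ?thesis
    using A by (simp add: front_on_def)
qed

text \<open>Reading \<open>g\<close> off on its deciding front gives a super-sequence, and a pair of
  front elements at which badness fails is realised by a single set inside \<open>A\<close>.\<close>

lemma bpo_locally_constant_array:
  assumes P: "bpo P r" and A: "infinite A" and g: "locally_constant A g"
    and gP: "\<And>B. infinite B \<Longrightarrow> B \<subseteq> A \<Longrightarrow> g B \<in> P"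
  obtains B where "infinite B" "B \<subseteq> A" "(g B, g (behead B)) \<in> r"
proof -
  let ?F = "deciding_front A g"
  \<comment> \<open>Appending all elements of \<open>A\<close> above \<open>s\<close> gives a
    canonical infinite set that begins with \<open>s\<close>.\<close>
  let ?ext = "\<lambda>s. s \<union> (A \<inter> {n. \<forall>x\<in>s. x < n})"
  have front: "front_on A ?F" using A g by (rule front_on_deciding_front)
  have ext: "infinite (?ext s)" "?ext s \<subseteq> A" "\<And>t. t \<sqsubseteq>\<^sub>i s \<Longrightarrow> t \<sqsubseteq>\<^sub>i ?ext s"
    if s: "finite s" "s \<subseteq> A" for s
  proof -
    obtain k where k: "\<forall>x\<in>s. x < k"
      using finite_nat_bounded[OF s(1)] by auto
    have "A \<subseteq> ?ext s \<union> {..k}" using k by (auto simp: not_le)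
    then show "infinite (?ext s)"
      using A by (meson finite_Un finite_atMost finite_subset)
    show "?ext s \<subseteq> A" using s(2) by blast
    show "t \<sqsubseteq>\<^sub>i ?ext s" if "t \<sqsubseteq>\<^sub>i s" for t
      unfolding init_seg_def
    proof (intro conjI ballI impI)
      show "t \<subseteq> ?ext s" using that unfolding init_seg_def by blast
      fix x b assume xb: "x \<in> t" "b \<in> ?ext s" "b < x"
      then have "x \<in> s" using that unfolding init_seg_def by blast
      then have "b \<in> s" using xb(2,3) not_less_iff_gr_or_eq by blast
      then show "b \<in> t" using that xb unfolding init_seg_def by blast
    qed
  qed
  define f where "f s = g (?ext s)" for s
  have fF: "finite s" "s \<subseteq> A" if "s \<in> ?F" for s
    using that unfolding deciding_front_def by blast+
  have f_eq: "f s = g B" if "s \<in> ?F" "infinite B" "B \<subseteq> A" "s \<sqsubseteq>\<^sub>i B" for s B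
  proof -
    have "s \<sqsubseteq>\<^sub>i ?ext s" by (rule ext(3)[OF fF[OF that(1)] init_seg_refl])
    moreover have "decides A g s" using that(1) unfolding deciding_front_def by blast
    ultimately show ?thesis
      unfolding f_def decides_def using ext(1,2)[OF fF[OF that(1)]] that(2-4) by blast
  qed
  have "f \<in> ?F \<rightarrow> P"
    unfolding f_def by (rule Pi_I, rule gP) (rule ext(1,2), erule fF, erule fF)+
  then have "super_sequence P ?F f"
    using front unfolding super_sequence_def front_def by blast
  then have "\<not> bad r ?F f"
    using P unfolding bpo_def by blast
  then obtain s t where st: "s \<in> ?F" "t \<in> ?F" "s \<lhd>\<^sub>s t" "(f s, f t) \<in> r"
    unfolding bad_def by blast
  then obtain B where B: "infinite B" "s \<sqsubseteq>\<^sub>i B" "t \<sqsubseteq>\<^sub>i behead B"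
    unfolding shift_rel_def behead_def by blast
  \<comment> \<open>The witness \<open>B\<close> of the shift relation need not lie in
    \<open>A\<close>; only its part \<open>s \<union> t\<close> is kept and continued within
    \<open>A\<close>.\<close>
  let ?B = "?ext (s \<union> t)"
  have u: "finite (s \<union> t)" "s \<union> t \<subseteq> A" using fF st by blast+
  have "s \<sqsubseteq>\<^sub>i s \<union> t"
    using B(2,3) behead_subset[of B] unfolding init_seg_def by blast
  then have s: "s \<sqsubseteq>\<^sub>i ?B" using ext(3)[OF u] by blast
  have t: "t \<sqsubseteq>\<^sub>i behead ?B"
  \<comment> \<open>An empty \<open>s\<close> misses the minimum of \<open>B\<close>, but then the
    antichain property makes \<open>t\<close> empty too. Otherwise the minimum of \<open>B\<close>
    lies in \<open>s\<close> and is also the minimum of \<open>?B\<close>.\<close>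
  proof (cases "s = {}")
    case True
    then have "{} \<in> ?F" using st(1) by simp
    then have "t = {}"
      using deciding_front_antichain[OF _ st(2) init_seg_empty] by simp
    then show ?thesis using init_seg_empty by simp
  next
    case False
    let ?m = "LEAST n. n \<in> B"
    have "?m \<in> B" using B(1) by (metis LeastI finite.emptyI ex_in_conv)
    then have m: "?m \<in> s"
      using False B(2) unfolding init_seg_def
      by (metis Least_le ex_in_conv le_neq_implies_less subset_iff)
    have least: "?m \<le> x" if "x \<in> s \<union> t" for x
      using that B behead_subset[of B] by (intro Least_le) (auto simp: init_seg_def)
    have "(LEAST n. n \<in> ?B) = ?m"
      using m least by (intro Least_equality) (auto intro: less_imp_le)
    moreover have "t \<subseteq> ?B - {?m}"
      using B(3) unfolding behead_def init_seg_def by blast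
    moreover have "b \<in> t" if "x \<in> t" "b \<in> ?B - {?m}" "b < x" for b x
    proof -
      have "b \<in> s \<union> t" using that not_less_iff_gr_or_eq by blast
      then have "b \<in> behead B"
        using B that(2) unfolding behead_def init_seg_def by blast
      then show ?thesis
        using B(3) that unfolding init_seg_def by blast
    qed
    ultimately show ?thesis unfolding behead_def init_seg_def by auto
  qed
  show ?thesis
  proof (rule that)
    show B: "infinite ?B" "?B \<subseteq> A" using ext(1,2)[OF u] .
    have "f s = g ?B" using f_eq[OF st(1) B s] .
    moreover have "f t = g (behead ?B)"
      using B behead_subset[of ?B] t by (intro f_eq[OF st(2)]) auto
    ultimately show "(g ?B, g (behead ?B)) \<in> r" using st(4) by simp
  qed
qed

section \<open>A Ramsey theorem for locally constant colourings\<close>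

text \<open>For \<open>s = {}\<close> this is constancy of \<open>c\<close> on all infinite subsets
  of \<open>H\<close>, the conclusion of Ramsey's theorem.\<close>

definition homogeneous :: "(nat set \<Rightarrow> bool) \<Rightarrow> nat set \<Rightarrow> nat set \<Rightarrow> bool" where
  "homogeneous c s H \<longleftrightarrow>
     (\<exists>v. \<forall>C. infinite C \<and> C \<subseteq> H \<and> (\<forall>x\<in>s. \<forall>y\<in>C. x < y) \<longrightarrow> c (s \<union> C) = v)"

text \<open>By diagonalisation: a decreasing chain is built in which each set is homogeneous for
  \<open>s\<close> with the previous minimum added. On the set of these minima the colour of
  \<open>s \<union> C\<close> depends only on the first element of \<open>C\<close>, and a
  pigeonhole argument makes it constant.\<close>

lemma homogeneous_step:
  assumes step: "\<And>n D. n \<in> A \<Longrightarrow> \<forall>x\<in>s. x < n \<Longrightarrow> infinite D \<Longrightarrow> D \<subseteq> A \<Longrightarrow>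
      \<exists>H. H \<subseteq> D \<and> infinite H \<and> homogeneous c (insert n s) H"
    and s: "finite s" and D: "infinite D" "D \<subseteq> A"
  shows "\<exists>H. H \<subseteq> D \<and> infinite H \<and> homogeneous c s H"
proof -
  define D0 where "D0 = {n \<in> D. \<forall>x\<in>s. x < n}"
  obtain k where k: "s \<subseteq> {..<k}" using finite_nat_bounded[OF s] by blast
  have "D \<subseteq> D0 \<union> {..<k}"
    using k unfolding D0_def by fastforce
  then have D0: "infinite D0"
    using D(1) by (meson finite_Un finite_lessThan finite_subset)
  let ?m = "\<lambda>X :: nat set. LEAST m. m \<in> X"
  have "\<exists>X. \<forall>k. (infinite (X k) \<and> X k \<subseteq> D0) \<and>
      (X (Suc k) \<subseteq> behead (X k) \<and> homogeneous c (insert (?m (X k)) s) (X (Suc k)))"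
  proof (rule dependent_nat_choice)
    show "\<exists>X. infinite X \<and> X \<subseteq> D0" using D0 by blast
    fix X :: "nat set" and k :: nat
    assume X: "infinite X \<and> X \<subseteq> D0"
    then have "?m X \<in> X" by (metis LeastI ex_in_conv finite.emptyI)
    then have m: "?m X \<in> A" "\<forall>x\<in>s. x < ?m X"
      using X D(2) unfolding D0_def by blast+
    have "behead X \<subseteq> A"
      using X behead_subset[of X] D(2) unfolding D0_def by blast
    then obtain H where "H \<subseteq> behead X" "infinite H" "homogeneous c (insert (?m X) s) H"
      using step[OF m, of "behead X"] X by auto
    then show "\<exists>Y. (infinite Y \<and> Y \<subseteq> D0) \<and> (Y \<subseteq> behead X \<and> homogeneous c (insert (?m X) s) Y)"
      using X behead_subset[of X] by blast
  qed
  then obtain X where X: "\<And>k. infinite (X k)" "\<And>k. X k \<subseteq> D0" "\<And>k. X (Suc k) \<subseteq> behead (X k)"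
      "\<And>k. homogeneous c (insert (?m (X k)) s) (X (Suc k))"
    by metis
  define m where "m k = ?m (X k)" for k
  have m: "m k \<in> X k" for k
    unfolding m_def using X(1)[of k] by (metis LeastI ex_in_conv finite.emptyI)
  have dec: "X j \<subseteq> X i" if "i \<le> j" for i j
    by (rule lift_Suc_antimono_le[OF _ that]) (use X(3) behead_subset in blast)
  have "m k < m (Suc k)" for k
    using least_less_behead[of "m (Suc k)" "X k"] m[of "Suc k"] X(3)[of k] unfolding m_def by blast
  then have mono: "strict_mono m" by (simp add: strict_mono_Suc_iff)
  have "\<exists>v. \<forall>C. infinite C \<and> C \<subseteq> X (Suc k) \<and> (\<forall>x\<in>insert (m k) s. \<forall>y\<in>C. x < y)
      \<longrightarrow> c (insert (m k) s \<union> C) = v" for k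
    using X(4)[of k] unfolding homogeneous_def m_def .
  then obtain v where v: "\<And>k C. infinite C \<Longrightarrow> C \<subseteq> X (Suc k) \<Longrightarrow>
      \<forall>x\<in>insert (m k) s. \<forall>y\<in>C. x < y \<Longrightarrow> c (insert (m k) s \<union> C) = v k"
    by metis
  obtain k0 where K: "infinite {k \<in> UNIV. v k = v k0}"
    using pigeonhole_infinite[of UNIV v] by auto
  define H where "H = m ` {k. v k = v k0}"
  have H: "infinite H"
    unfolding H_def using K strict_mono_imp_inj_on[OF mono]
    by (simp add: finite_image_iff inj_on_subset)
  have "H \<subseteq> D0" using m X(2) unfolding H_def by blast
  then have HD: "H \<subseteq> D" unfolding D0_def by blast
  have "c (s \<union> C) = v k0" if C: "infinite C" "C \<subseteq> H" "\<forall>x\<in>s. \<forall>y\<in>C. x < y" for C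
  proof -
    have ne: "C \<noteq> {}" using C(1) by auto
    then have "?m C \<in> C" by (metis LeastI ex_in_conv)
    then obtain k where k: "?m C = m k" "v k = v k0" using C(2) unfolding H_def by auto
    \<comment> \<open>A set \<open>C\<close> starting at \<open>m k\<close> continues with later
      minima, all of which lie in \<open>X (Suc k)\<close>.\<close>
    have "behead C \<subseteq> X (Suc k)"
    proof
      fix y assume y: "y \<in> behead C"
      then have "y \<in> C" using behead_subset by blast
      then obtain j where j: "y = m j" using C(2) unfolding H_def by auto
      have "m k < m j" using least_less_behead[OF y] k(1) j by simp
      then have "Suc k \<le> j" using strict_mono_less[OF mono] by simp
      then show "y \<in> X (Suc k)" using dec m j by blast
    qed
    moreover have "\<forall>x\<in>insert (m k) s. \<forall>y\<in>behead C. x < y"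
      using least_less_behead[of _ C] k(1) C(3) behead_subset[of C] by auto
    ultimately have "c (insert (m k) s \<union> behead C) = v k"
      using v[of "behead C" k] C(1) by simp
    moreover have "insert (m k) s \<union> behead C = s \<union> C"
      using insert_least_behead[OF ne] k(1) by auto
    ultimately show ?thesis using k(2) by simp
  qed
  then have "homogeneous c s H"
    unfolding homogeneous_def by (intro exI[of _ "v k0"]) simp
  then show ?thesis
    using H HD by blast
qed

text \<open>The finite sets with no homogeneous set form a tree; an infinite branch through it would
  contradict local constancy, and \<open>homogeneous_step\<close> says that the tree has no leaves.\<close>

lemma locally_constant_homogeneous:
  assumes c: "locally_constant A c" and A: "infinite A"
  shows "\<exists>H. H \<subseteq> A \<and> infinite H \<and> homogeneous c {} H"
proof (rule ccontr)
  assume no: "\<not> ?thesis"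
  \<comment> \<open>Homogeneous sets are demanded inside every infinite \<open>D\<close>, not just
    inside \<open>A\<close>; this is what lets \<open>homogeneous_step\<close> shrink
    repeatedly.\<close>
  define T where "T s \<longleftrightarrow> (\<forall>D. infinite D \<and> D \<subseteq> A \<longrightarrow>
      (\<exists>H. H \<subseteq> D \<and> infinite H \<and> homogeneous c s H))" for s
  have "\<exists>S. \<forall>k. (finite (S k) \<and> S k \<subseteq> A \<and> \<not> T (S k)) \<and>
      (\<exists>n\<in>A. (\<forall>x\<in>S k. x < n) \<and> S (Suc k) = insert n (S k))"
  proof (rule dependent_nat_choice)
    have "\<not> T {}" using no A unfolding T_def by blast
    then show "\<exists>s. finite s \<and> s \<subseteq> A \<and> \<not> T s" by blast
    fix s :: "nat set" and k :: nat
    assume s: "finite s \<and> s \<subseteq> A \<and> \<not> T s"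
    have "\<exists>n\<in>A. (\<forall>x\<in>s. x < n) \<and> \<not> T (insert n s)"
    proof (rule ccontr)
      assume *: "\<not> ?thesis"
      have step: "\<exists>H. H \<subseteq> D \<and> infinite H \<and> homogeneous c (insert n s) H"
        if n: "n \<in> A" "\<forall>x\<in>s. x < n" and D: "infinite D" "D \<subseteq> A" for n D
      proof -
        have "T (insert n s)" using * n by blast
        then show ?thesis using D unfolding T_def by simp
      qed
      have "\<exists>H. H \<subseteq> D \<and> infinite H \<and> homogeneous c s H" if "infinite D" "D \<subseteq> A" for D
        using step conjunct1[OF s] that by (rule homogeneous_step)
      then have "T s" unfolding T_def by simp
      then show False using s by blast
    qed
    then show "\<exists>t. (finite t \<and> t \<subseteq> A \<and> \<not> T t) \<and> (\<exists>n\<in>A. (\<forall>x\<in>s. x < n) \<and> t = insert n s)"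
      using s by blast
  qed
  then obtain S n where S: "\<And>k. finite (S k)" "\<And>k. S k \<subseteq> A" "\<And>k. \<not> T (S k)"
      "\<And>k x. x \<in> S k \<Longrightarrow> x < n k" "\<And>k. S (Suc k) = insert (n k) (S k)"
    by metis
  have mono: "S i \<subseteq> S j" if "i \<le> j" for i j
    by (rule lift_Suc_mono_le[OF _ that]) (use S(5) in blast)
  have above: "n i \<le> n j" if "i \<le> j" for i j
    by (rule lift_Suc_mono_le[OF _ that]) (use S(4,5) in \<open>simp add: less_imp_le\<close>)
  define B where "B = (\<Union>k. S k)"
  have "card (S k) \<ge> k" for k
  proof (induction k)
    case (Suc k)
    have "n k \<notin> S k" using S(4)[of "n k" k] by blast
    then show ?case using Suc S(1)[of k] by (simp add: S(5))
  qed simp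
  then have B: "infinite B" unfolding B_def
    by (metis UN_upper UNIV_I card_mono not_less_eq_eq order_trans)
  have BA: "B \<subseteq> A" using S(2) unfolding B_def by blast
  obtain l where l: "\<And>C. infinite C \<Longrightarrow> C \<subseteq> A \<Longrightarrow> C \<inter> {..<l} = B \<inter> {..<l} \<Longrightarrow> c C = c B"
    using locally_constantD[OF c B BA] by metis
  obtain b where b: "b \<in> B" "l \<le> b" using B by (auto simp: infinite_nat_iff_unbounded_le)
  then obtain k where k: "b \<in> S k" unfolding B_def by blast
  \<comment> \<open>Elements added from stage \<open>k\<close> on exceed \<open>b\<close>, hence are
    not below \<open>l\<close>, so \<open>S k\<close> already holds all of \<open>B\<close> below
    \<open>l\<close>.\<close>
  have low: "x \<in> S k" if x: "x \<in> B" "x < l" for x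
  proof -
    obtain j where j: "x \<in> S j" using x(1) unfolding B_def by blast
    have "x \<in> S (k + d)  \<Longrightarrow> x \<in> S k" for d
    proof (induction d)
      case (Suc d)
      have "x < n (k + d)"
        using S(4)[OF k] above[of k "k + d"] x(2) b(2) by simp
      then show ?case using Suc S(5)[of "k + d"] by auto
    qed simp
    moreover have "x \<in> S (k + j)" using j mono[of j "k + j"] by auto
    ultimately show ?thesis by blast
  qed
  have "c (S k \<union> C) = c B" if C: "infinite C" "C \<subseteq> A" "\<forall>x\<in>S k. \<forall>y\<in>C. x < y" for C
  proof (rule l)
    show "infinite (S k \<union> C)" "S k \<union> C \<subseteq> A" using C S(2) by auto
    have "\<not> y < l" if "y \<in> C" for y
      using C(3) k that b(2) by fastforce
    moreover have "S k \<subseteq> B" unfolding B_def by blast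
    ultimately show "(S k \<union> C) \<inter> {..<l} = B \<inter> {..<l}" using low by auto
  qed
  then have "homogeneous c (S k) D" if "D \<subseteq> A" for D
    using that unfolding homogeneous_def by (intro exI[of _ "c B"]) auto
  then have "T (S k)" unfolding T_def by auto
  then show False using S(3) by blast
qed

lemma locally_constant_Ramsey:
  assumes "locally_constant A c" "infinite A"
  obtains H where "infinite H" "H \<subseteq> A"
    "(\<forall>B. infinite B \<and> B \<subseteq> H \<longrightarrow> c B) \<or> (\<forall>B. infinite B \<and> B \<subseteq> H \<longrightarrow> \<not> c B)"
proof -
  obtain H v where H: "H \<subseteq> A" "infinite H" "\<And>B. infinite B \<and> B \<subseteq> H \<longrightarrow> c B = v"
    using locally_constant_homogeneous[OF assms] unfolding homogeneous_def by auto
  then show ?thesis by (intro that[of H]) (cases v; simp)+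
qed

text \<open>Ramsey's theorem makes domination hold for all \<open>B\<close> or fail for all
  \<open>B\<close>. In the second case the undominated elements form an array in \<open>P\<close>,
  which \<open>bpo_locally_constant_array\<close> rules out.\<close>

lemma bpo_domination:
  assumes P: "bpo P r" and A: "infinite A" and S: "locally_constant A S"
    and SP: "\<And>B. infinite B \<Longrightarrow> B \<subseteq> A \<Longrightarrow> S B \<subseteq> P"
  obtains H where "infinite H" "H \<subseteq> A"
    "\<And>B y. infinite B \<Longrightarrow> B \<subseteq> H \<Longrightarrow> y \<in> S (behead B) \<Longrightarrow> \<exists>x\<in>S B. (x, y) \<in> r"
proof -
  let ?c = "\<lambda>B. \<forall>y\<in>S (behead B). \<exists>x\<in>S B. (x, y) \<in> r"
  have c: "locally_constant A ?c"
    by (rule locally_constant_step[OF S, where h = "\<lambda>X Y. \<forall>y\<in>Y. \<exists>x\<in>X. (x, y) \<in> r"])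
  obtain H where H: "infinite H" "H \<subseteq> A"
    "(\<forall>B. infinite B \<and> B \<subseteq> H \<longrightarrow> ?c B) \<or> (\<forall>B. infinite B \<and> B \<subseteq> H \<longrightarrow> \<not> ?c B)"
    by (rule locally_constant_Ramsey[OF c A])
  from H(3) show ?thesis
  proof
    assume "\<forall>B. infinite B \<and> B \<subseteq> H \<longrightarrow> ?c B"
    then show ?thesis using H(1,2) by (intro that[of H]) auto
  next
    assume bad: "\<forall>B. infinite B \<and> B \<subseteq> H \<longrightarrow> \<not> ?c B"
    define pick where "pick X Y = (SOME y. y \<in> Y \<and> (\<forall>x\<in>X. (x, y) \<notin> r))" for X Y
    define g where "g B = pick (S B) (S (behead B))" for B
    have g: "g B \<in> S (behead B) \<and> (\<forall>x\<in>S B. (x, g B) \<notin> r)" if "infinite B" "B \<subseteq> H" for B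
    proof -
      have "\<not> ?c B" using bad that by simp
      then have "\<exists>y. y \<in> S (behead B) \<and> (\<forall>x\<in>S B. (x, y) \<notin> r)" by blast
      then show ?thesis unfolding g_def pick_def by (rule someI_ex)
    qed
    have lg: "locally_constant H g"
      unfolding g_def using locally_constant_step[OF locally_constant_subset[OF S H(2)]] .
    have gP: "g B \<in> P" if "infinite B" "B \<subseteq> H" for B
    proof -
      have "S (behead B) \<subseteq> P"
        using that H(2) behead_subset[of B] by (intro SP) auto
      then show ?thesis using g[OF that] by blast
    qed
    obtain B where B: "infinite B" "B \<subseteq> H" "(g B, g (behead B)) \<in> r"
      by (rule bpo_locally_constant_array[OF P H(1) lg gP])
    have "infinite (behead B)" "behead B \<subseteq> H" using B behead_subset[of B] by auto
    \<comment> \<open>\<open>g B\<close> lies in \<open>S (behead B)\<close>, whereas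
      \<open>g (behead B)\<close> is above no element of \<open>S (behead B)\<close>.\<close>
    then show ?thesis using g[of B] g[of "behead B"] B by blast
  qed
qed

section \<open>Hall's marriage theorem\<close>

text \<open>By induction on \<open>X\<close>: if a nonempty proper \<open>Y\<close> has exactly
  \<open>card Y\<close> neighbours, then \<open>Y\<close> and the rest are matched separately;
  otherwise every such set has a neighbour to spare, and one element may be matched
  arbitrarily.\<close>

lemma Hall_marriage:
  assumes "finite X" "\<And>x. x \<in> X \<Longrightarrow> finite (E x)"
    and "\<And>Y. Y \<subseteq> X \<Longrightarrow> card Y \<le> card (\<Union>x\<in>Y. E x)"
  shows "\<exists>f. inj_on f X \<and> (\<forall>x\<in>X. f x \<in> E x)"
  using assms
proof (induction X arbitrary: E rule: finite_psubset_induct)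
  case (psubset X)
  note finE = psubset.prems(1) and hall = psubset.prems(2)
  have finU: "finite (\<Union>x\<in>Y. E x)" if "Y \<subseteq> X" for Y
    using that psubset.hyps finE by (meson finite_UN_I finite_subset subset_eq)
  show ?case
  proof (cases "\<exists>Y. Y \<subset> X \<and> Y \<noteq> {} \<and> card (\<Union>x\<in>Y. E x) = card Y")
    case True
    then obtain Y where Y: "Y \<subset> X" "Y \<noteq> {}" "card (\<Union>x\<in>Y. E x) = card Y" by blast
    let ?U = "\<Union>x\<in>Y. E x"
    have finY: "finite Y" using Y(1) psubset.hyps by (meson finite_subset psubsetE)
    obtain f1 where f1: "inj_on f1 Y" "\<And>x. x \<in> Y \<Longrightarrow> f1 x \<in> E x"
      using psubset.IH[OF Y(1), of E] Y(1) finE hall by (metis psubsetE subset_eq)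
    have "\<exists>f. inj_on f (X - Y) \<and> (\<forall>x\<in>X - Y. f x \<in> E x - ?U)"
    proof (rule psubset.IH)
      show "X - Y \<subset> X" using Y by blast
      show "finite (E x - ?U)" if "x \<in> X - Y" for x using that finE by blast
      fix Z assume Z: "Z \<subseteq> X - Y"
      \<comment> \<open>Hall's condition for \<open>Z \<union> Y\<close>, less the
        \<open>card Y\<close> neighbours of \<open>Y\<close>, yields the condition for
        \<open>Z\<close>.\<close>
      have eq: "(\<Union>x\<in>Z. E x - ?U) = (\<Union>x\<in>Z \<union> Y. E x) - ?U" by blast
      have finZ: "finite Z" using Z psubset.hyps by (meson Diff_subset finite_subset)
      have "card Z + card Y = card (Z \<union> Y)"
        using Z finY finZ by (intro card_Un_disjoint[symmetric]) auto
      also have "\<dots> \<le> card (\<Union>x\<in>Z \<union> Y. E x)" using Z Y by (intro hall) auto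
      finally have "card Z \<le> card (\<Union>x\<in>Z \<union> Y. E x) - card ?U" using Y(3) by simp
      also have "\<dots> = card ((\<Union>x\<in>Z \<union> Y. E x) - ?U)"
        using finU[of Y] Y(1) by (intro card_Diff_subset[symmetric]) auto
      finally show "card Z \<le> card (\<Union>x\<in>Z. E x - ?U)" using eq by simp
    qed
    then obtain f2 where f2: "inj_on f2 (X - Y)" "\<And>x. x \<in> X - Y \<Longrightarrow> f2 x \<in> E x - ?U" by blast
    define f where "f x = (if x \<in> Y then f1 x else f2 x)" for x
    have "inj_on f X"
    proof (rule inj_onI)
      fix x y assume xy: "x \<in> X" "y \<in> X" "f x = f y"
      have sep: "f1 u \<noteq> f2 w" if "u \<in> Y" "w \<in> X - Y" for u w
        using f1(2)[OF that(1)] f2(2)[OF that(2)] that(1) by auto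
      show "x = y"
        using xy f1(1) f2(1) sep[of x y] sep[of y x] unfolding f_def inj_on_def
        by (auto split: if_splits)
    qed
    moreover have "f x \<in> E x" if "x \<in> X" for x
      using that f1(2)[of x] f2(2)[of x] unfolding f_def by auto
    ultimately show ?thesis by blast
  next
    case False
    show ?thesis
    proof (cases "X = {}")
      case True
      then show ?thesis by simp
    next
      case nonempty: False
      then obtain x where x: "x \<in> X" by blast
      have "card {x} \<le> card (\<Union>z\<in>{x}. E z)" using x by (intro hall) simp
      then obtain y where y: "y \<in> E x" by fastforce
      have "\<exists>f. inj_on f (X - {x}) \<and> (\<forall>z\<in>X - {x}. f z \<in> E z - {y})"
      proof (rule psubset.IH)
        show "X - {x} \<subset> X" using x by blast
        show "finite (E z - {y})" if "z \<in> X - {x}" for z using that finE by blast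
        fix Z assume Z: "Z \<subseteq> X - {x}"
        have eq: "(\<Union>z\<in>Z. E z - {y}) = (\<Union>z\<in>Z. E z) - {y}" by blast
        show "card Z \<le> card (\<Union>z\<in>Z. E z - {y})"
        proof (cases "Z = {}")
          case False
          then have "card Z < card (\<Union>z\<in>Z. E z)"
            using \<open>\<not> (\<exists>Y. Y \<subset> X \<and> Y \<noteq> {} \<and> card (\<Union>x\<in>Y. E x) = card Y)\<close> Z x hall[of Z]
            by (metis Diff_empty insert_Diff1 le_neq_implies_less psubsetI singletonI subset_Diff_insert)
          moreover have "card (\<Union>z\<in>Z. E z) - 1 \<le> card ((\<Union>z\<in>Z. E z) - {y})"
            by (simp add: card_Diff_singleton_if)
          ultimately show ?thesis unfolding eq by simp
        qed simp
      qed
      then obtain f where f: "inj_on f (X - {x})" "\<And>z. z \<in> X - {x} \<Longrightarrow> f z \<in> E z - {y}" by blast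
      have "inj_on (f(x := y)) (insert x (X - {x}))"
        using f by (auto simp: inj_on_def)
      moreover have "\<forall>z\<in>X. (f(x := y)) z \<in> E z" using f(2) y by auto
      ultimately show ?thesis using x by (metis insert_Diff)
    qed
  qed
qed

section \<open>Multiset projectivity\<close>

lemma finite_occurrences [simp]: "finite (occurrences M)"
  by (simp add: occurrences_def)

lemma fst_occurrences [simp]: "fst ` occurrences M = set_mset M"
  by (auto simp: occurrences_def fst_image_Sigma lessThan_empty_iff)

lemma fst_in_occurrences: "p \<in> occurrences M \<Longrightarrow> fst p \<in># M"
  by (auto simp: occurrences_def)

lemma card_occurrences_fst: "card {p \<in> occurrences M. fst p = b} = count M b"
proof -
  have "{p \<in> occurrences M. fst p = b} = Pair b ` {..<count M b}"
    by (auto simp: occurrences_def simp flip: count_greater_zero_iff)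
  then show ?thesis by (simp add: card_image inj_on_def)
qed

lemma mset_projI:
  assumes "N \<in> multisets_over P" "M \<in> multisets_over P" "f ` occurrences M = occurrences N"
    "\<And>p. p \<in> occurrences M \<Longrightarrow> (fst (f p), fst p) \<in> r"
  shows "(N, M) \<in> mset_proj P r"
  unfolding mset_proj_def using assms(1,2) by (simp, intro exI[of _ f] conjI ballI assms(3,4))

lemma mset_proj_subset: "mset_proj P r \<subseteq> multisets_over P \<times> multisets_over P"
  unfolding mset_proj_def by blast

lemma mset_projE:
  assumes "(N, M) \<in> mset_proj P r"
  obtains f where "f ` occurrences M = occurrences N"
    "\<And>p. p \<in> occurrences M \<Longrightarrow> (fst (f p), fst p) \<in> r"
  using assms unfolding mset_proj_def by blast

text \<open>The inverse of \<open>i\<close> is a lowering map on the image of \<open>i\<close> that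
  already hits all of \<open>N\<close>; \<open>dom\<close> sends the remaining occurrences to
  something below them.\<close>

lemma mset_projI_inj:
  assumes NM: "N \<in> multisets_over P" "M \<in> multisets_over P"
    and inj: "inj_on i (occurrences N)" "i ` occurrences N \<subseteq> occurrences M"
    and i: "\<And>p. p \<in> occurrences N \<Longrightarrow> (fst p, fst (i p)) \<in> r"
    and dom: "\<And>y. y \<in># M \<Longrightarrow> \<exists>x\<in>#N. (x, y) \<in> r"
  shows "(N, M) \<in> mset_proj P r"
proof -
  let ?I = "i ` occurrences N"
  have ex: "\<exists>p. p \<in> occurrences N \<and> (fst p, fst q) \<in> r" if q: "q \<in> occurrences M" for q
  proof -
    obtain x where "x \<in># N" "(x, fst q) \<in> r"
      using dom fst_in_occurrences[OF q] by blast
    then show ?thesis by (metis fst_occurrences imageE)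
  qed
  then obtain h where h: "\<And>q. q \<in> occurrences M \<Longrightarrow> h q \<in> occurrences N"
      "\<And>q. q \<in> occurrences M \<Longrightarrow> (fst (h q), fst q) \<in> r"
    by metis
  define f where "f q = (if q \<in> ?I then inv_into (occurrences N) i q else h q)" for q
  have fi: "f (i p) = p" if "p \<in> occurrences N" for p
    using that inj(1) by (simp add: f_def)
  have "f ` occurrences M = occurrences N"
  proof
    show "f ` occurrences M \<subseteq> occurrences N"
      using h(1) fi unfolding f_def by (auto intro: inv_into_into)
    show "occurrences N \<subseteq> f ` occurrences M"
      using fi inj(2) by (metis image_subset_iff imageI subsetI)
  qed
  moreover have "(fst (f q), fst q) \<in> r" if "q \<in> occurrences M" for q
  proof (cases "q \<in> ?I")
    case True
    then show ?thesis using fi i by auto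
  next
    case False
    then show ?thesis using h(2)[OF that] by (simp add: f_def)
  qed
  ultimately show ?thesis by (rule mset_projI[OF NM])
qed

text \<open>A bijection of occurrences that lowers elements can only enlarge the part of a multiset
  inside a down-set; applied in both directions to the down-sets
  \<open>{a. a \<le> b}\<close> and \<open>{a. a < b}\<close> this pins down the multiplicity of \<open>b\<close>.\<close>

lemma mset_proj_card_down_set:
  assumes "(N, M) \<in> mset_proj P r" "card (occurrences N) = card (occurrences M)"
    and down: "\<And>a b. b \<in> D \<Longrightarrow> (a, b) \<in> r \<Longrightarrow> a \<in> D"
  shows "card {p \<in> occurrences M. fst p \<in> D} \<le> card {p \<in> occurrences N. fst p \<in> D}"
proof -
  obtain f where f: "f ` occurrences M = occurrences N"
    "\<And>p. p \<in> occurrences M \<Longrightarrow> (fst (f p), fst p) \<in> r"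
    using mset_projE[OF assms(1)] by blast
  have "inj_on f (occurrences M)"
    using f(1) assms(2) by (intro eq_card_imp_inj_on) simp_all
  then have "inj_on f {p \<in> occurrences M. fst p \<in> D}"
    by (rule inj_on_subset) blast
  moreover have "f ` {p \<in> occurrences M. fst p \<in> D} \<subseteq> {p \<in> occurrences N. fst p \<in> D}"
    using f down by blast
  ultimately show ?thesis by (rule card_inj_on_le) simp
qed

lemma mset_proj_card_le:
  "(N, M) \<in> mset_proj P r \<Longrightarrow> card (occurrences N) \<le> card (occurrences M)"
  by (metis card_image_le finite_occurrences mset_projE)

lemma partial_order_on_mset_proj:
  assumes P: "partial_order_on P r"
  shows "partial_order_on (multisets_over P) (mset_proj P r)"
proof -
  have refl: "\<And>x. x \<in> P \<Longrightarrow> (x, x) \<in> r" and trans: "trans r" and antisym: "antisym r"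
    using P unfolding partial_order_on_def preorder_on_def refl_on_def by blast+
  have "refl_on (multisets_over P) (mset_proj P r)"
  proof (rule refl_onI)
    fix M assume M: "M \<in> multisets_over P"
    then have "(fst p, fst p) \<in> r" if "p \<in> occurrences M" for p
      using fst_in_occurrences[OF that] refl unfolding multisets_over_def by blast
    then show "(M, M) \<in> mset_proj P r"
      using M by (intro mset_projI[where f = id]) simp_all
  qed
  moreover have "trans (mset_proj P r)"
  proof (rule transI)
    fix K N M assume KN: "(K, N) \<in> mset_proj P r" and NM: "(N, M) \<in> mset_proj P r"
    obtain f where f: "f ` occurrences N = occurrences K"
      "\<And>p. p \<in> occurrences N \<Longrightarrow> (fst (f p), fst p) \<in> r" using mset_projE[OF KN] by blast
    obtain g where g: "g ` occurrences M = occurrences N"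
      "\<And>p. p \<in> occurrences M \<Longrightarrow> (fst (g p), fst p) \<in> r" using mset_projE[OF NM] by blast
    have "(f \<circ> g) ` occurrences M = occurrences K" using f(1) g(1) by (metis image_comp)
    moreover have "(fst ((f \<circ> g) p), fst p) \<in> r" if "p \<in> occurrences M" for p
    proof -
      have "g p \<in> occurrences N" using g(1) that by blast
      then show ?thesis using transD[OF trans f(2) g(2)[OF that]] by simp
    qed
    ultimately show "(K, M) \<in> mset_proj P r"
      using KN NM mset_proj_subset by (intro mset_projI[where f = "f \<circ> g"]) blast+
  qed
  moreover have "antisym (mset_proj P r)"
  proof (rule antisymI)
    fix M N assume MN: "(M, N) \<in> mset_proj P r" and NM: "(N, M) \<in> mset_proj P r"
    \<comment> \<open>Equal totals turn surjections in both directions into bijections.\<close>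
    have card: "card (occurrences N) = card (occurrences M)"
      using mset_proj_card_le[OF MN] mset_proj_card_le[OF NM] by simp
    have eq: "card {p \<in> occurrences M. fst p \<in> D} = card {p \<in> occurrences N. fst p \<in> D}"
      if "\<And>a b. b \<in> D \<Longrightarrow> (a, b) \<in> r \<Longrightarrow> a \<in> D" for D
      using mset_proj_card_down_set[OF MN card[symmetric] that]
        mset_proj_card_down_set[OF NM card that] by (rule order_antisym[rotated])
    show "M = N"
    proof (rule multiset_eqI)
      fix b
      \<comment> \<open>\<open>b\<close> is arbitrary and reflexivity is known only on
        \<open>P\<close>, so \<open>b\<close> is inserted explicitly.\<close>
      have count: "card {p \<in> occurrences K. fst p \<in> insert b {a. (a, b) \<in> r}}
          = count K b + card {p \<in> occurrences K. fst p \<in> {a. (a, b) \<in> r} - {b}}" for K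
      proof -
        have "{p \<in> occurrences K. fst p \<in> insert b {a. (a, b) \<in> r}} =
            {p \<in> occurrences K. fst p = b} \<union>
            {p \<in> occurrences K. fst p \<in> {a. (a, b) \<in> r} - {b}}" by blast
        then have "card {p \<in> occurrences K. fst p \<in> insert b {a. (a, b) \<in> r}} =
            card {p \<in> occurrences K. fst p = b} +
            card {p \<in> occurrences K. fst p \<in> {a. (a, b) \<in> r} - {b}}"
          by (simp only:) (rule card_Un_disjoint; auto)
        then show ?thesis by (simp only: card_occurrences_fst)
      qed
      have "card {p \<in> occurrences M. fst p \<in> insert b {a. (a, b) \<in> r}} =
          card {p \<in> occurrences N. fst p \<in> insert b {a. (a, b) \<in> r}}"
        by (rule eq) (use transD[OF trans] in blast)
      \<comment> \<open>Antisymmetry keeps the strict down-set of \<open>b\<close> closed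
        downwards.\<close>
      moreover have "card {p \<in> occurrences M. fst p \<in> {a. (a, b) \<in> r} - {b}} =
          card {p \<in> occurrences N. fst p \<in> {a. (a, b) \<in> r} - {b}}"
        by (rule eq) (use transD[OF trans] antisymD[OF antisym] in blast)
      ultimately show "count M b = count N b"
        using count[of M] count[of N] by linarith
    qed
  qed
  ultimately show ?thesis
    using mset_proj_subset unfolding partial_order_on_def preorder_on_def by blast
qed

section \<open>Hall violators and infinite descent\<close>

definition Hall_violator :: "'a rel \<Rightarrow> 'a multiset \<Rightarrow> 'a multiset \<Rightarrow> ('a \<times> nat) set \<Rightarrow> bool" where
  "Hall_violator r N M X \<longleftrightarrow> X \<subseteq> occurrences N \<and>
     card {q \<in> occurrences M. \<exists>p\<in>X. (fst p, fst q) \<in> r} < card X"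

text \<open>Without a violator, Hall's theorem on the comparability graph gives an increasing
  injection of occurrences, and \<open>dom\<close> completes it to a projection.\<close>

lemma Hall_violator_exists:
  assumes NM: "N \<in> multisets_over P" "M \<in> multisets_over P"
    and dom: "\<And>y. y \<in># M \<Longrightarrow> \<exists>x\<in>#N. (x, y) \<in> r"
    and "(N, M) \<notin> mset_proj P r"
  shows "\<exists>X. Hall_violator r N M X"
proof (rule ccontr)
  assume no: "\<not> ?thesis"
  let ?E = "\<lambda>p. {q \<in> occurrences M. (fst p, fst q) \<in> r}"
  have "\<exists>i. inj_on i (occurrences N) \<and> (\<forall>p\<in>occurrences N. i p \<in> ?E p)"
  proof (rule Hall_marriage)
    fix Y assume Y: "Y \<subseteq> occurrences N"
    have eq: "(\<Union>p\<in>Y. ?E p) = {q \<in> occurrences M. \<exists>p\<in>Y. (fst p, fst q) \<in> r}" by blast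
    have "\<not> Hall_violator r N M Y" using no by blast
    then show "card Y \<le> card (\<Union>p\<in>Y. ?E p)"
      using Y unfolding Hall_violator_def eq by simp
  qed simp_all
  then obtain i where "inj_on i (occurrences N)" "\<forall>p\<in>occurrences N. i p \<in> ?E p" by blast
  then have "(N, M) \<in> mset_proj P r"
    using dom by (intro mset_projI_inj[OF NM, of i]) auto
  then show False using assms(4) by blast
qed

lemma multiset_locally_constant_array:
  assumes P: "bpo P r" and A: "infinite A" and g: "locally_constant A g"
    and gP: "\<And>B. infinite B \<Longrightarrow> B \<subseteq> A \<Longrightarrow> g B \<in> multisets_over P"
  shows "\<exists>B. infinite B \<and> B \<subseteq> A \<and> (g B, g (behead B)) \<in> mset_proj P r"
proof (rule ccontr)
  assume bad: "\<not> ?thesis"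
  have gP': "set_mset (g B) \<subseteq> P" if "infinite B" "B \<subseteq> A" for B
    using gP[OF that] by (simp add: multisets_over_def)
  obtain H where H: "infinite H" "H \<subseteq> A" and dom:
    "\<And>B y. infinite B \<Longrightarrow> B \<subseteq> H \<Longrightarrow> y \<in># g (behead B) \<Longrightarrow> \<exists>x\<in>#g B. (x, y) \<in> r"
    using bpo_domination[OF P A locally_constant_compose[OF g, of set_mset] gP'] by blast
  define X where "X B = (SOME X. Hall_violator r (g B) (g (behead B)) X)" for B
  have X: "Hall_violator r (g B) (g (behead B)) (X B)" if B: "infinite B" "B \<subseteq> H" for B
  proof -
    have BA: "B \<subseteq> A" "behead B \<subseteq> A" using B(2) H(2) behead_subset[of B] by blast+
    have "\<exists>X. Hall_violator r (g B) (g (behead B)) X"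
    proof (rule Hall_violator_exists)
      show "g B \<in> multisets_over P" "g (behead B) \<in> multisets_over P"
        using gP B(1) BA by simp_all
      show "\<exists>x\<in>#g B. (x, y) \<in> r" if "y \<in># g (behead B)" for y
        using dom[OF B that] .
      show "(g B, g (behead B)) \<notin> mset_proj P r" using bad B(1) BA by blast
    qed
    then show ?thesis unfolding X_def by (rule someI_ex)
  qed
  have "locally_constant H X"
    unfolding X_def
    by (rule locally_constant_step[OF locally_constant_subset[OF g H(2)],
          where h = "\<lambda>N M. SOME X. Hall_violator r N M X"])
  then have lX: "locally_constant H (\<lambda>B. fst ` X B)" by (rule locally_constant_compose)
  have XP: "fst ` X B \<subseteq> P" if "infinite B" "B \<subseteq> H" for B
  proof -
    have "fst ` X B \<subseteq> set_mset (g B)"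
      using X[OF that] unfolding Hall_violator_def by (metis fst_occurrences image_mono)
    then show ?thesis using gP'[of B] that H(2) by blast
  qed
  obtain H' where H': "infinite H'" "H' \<subseteq> H" and domX:
    "\<And>B y. infinite B \<Longrightarrow> B \<subseteq> H' \<Longrightarrow> y \<in> fst ` X (behead B) \<Longrightarrow> \<exists>x\<in>fst ` X B. (x, y) \<in> r"
    using bpo_domination[OF P H(1) lX XP] by blast
  \<comment> \<open>By \<open>domX\<close>, \<open>X (behead B)\<close> sits among the occurrences
    above \<open>X B\<close>, which the violator property limits to fewer than
    \<open>card (X B)\<close>.\<close>
  have dec: "card (X (behead B)) < card (X B)" if B: "infinite B" "B \<subseteq> H'" for B
  proof -
    have "behead B \<subseteq> H" "B \<subseteq> H" using B(2) H'(2) behead_subset[of B] by blast+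
    then have "X (behead B) \<subseteq> occurrences (g (behead B))"
      and less: "card {q \<in> occurrences (g (behead B)). \<exists>p\<in>X B. (fst p, fst q) \<in> r} < card (X B)"
      using X[of "behead B"] X[of B] B(1) unfolding Hall_violator_def by simp_all
    then have "X (behead B) \<subseteq> {q \<in> occurrences (g (behead B)). \<exists>p\<in>X B. (fst p, fst q) \<in> r}"
      using domX[OF B] by blast
    then have "card (X (behead B)) \<le>
        card {q \<in> occurrences (g (behead B)). \<exists>p\<in>X B. (fst p, fst q) \<in> r}"
      by (intro card_mono) simp_all
    then show ?thesis using less by simp
  qed
  \<comment> \<open>\<open>behead\<close> can be repeated inside \<open>H'\<close>, so the sizes
    would drop forever.\<close>
  have False if "infinite B" "B \<subseteq> H'" for B
    using that
  proof (induction "card (X B)" arbitrary: B rule: less_induct)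
    case less
    show ?case
      using less.hyps[OF dec[OF less.prems]] less.prems behead_subset[of B] by auto
  qed
  then show False using H'(1) by blast
qed

theorem theorem2p12:
  fixes P :: "'a set" and le :: "'a rel"
  assumes "bpo P le"
  shows "bpo (multisets_over P) (mset_proj P le)"
proof -
  have "False" if F: "super_sequence (multisets_over P) F f" "bad (mset_proj P le) F f" for F f
  proof -
    obtain A where A: "front_on A F" and f: "f \<in> F \<rightarrow> multisets_over P"
      using F(1) unfolding super_sequence_def front_def by blast
    have inf: "infinite A" using A unfolding front_on_def by simp
    define S where "S B = (THE s. s \<in> F \<and> s \<sqsubseteq>\<^sub>i B)" for B
    have S: "S B \<in> F \<and> S B \<sqsubseteq>\<^sub>i B" if "infinite B" "B \<subseteq> A" for B
      unfolding S_def using front_on_unique[OF A that] by (rule theI')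
    have "locally_constant A (\<lambda>B. f (S B))"
      unfolding S_def using A by (rule locally_constant_front_array)
    moreover have "f (S B) \<in> multisets_over P" if "infinite B" "B \<subseteq> A" for B
      using f S[OF that] by blast
    ultimately obtain B where B: "infinite B" "B \<subseteq> A"
        and le: "(f (S B), f (S (behead B))) \<in> mset_proj P le"
      using multiset_locally_constant_array[OF assms inf] by metis
    have "infinite (behead B)" "behead B \<subseteq> A" using B behead_subset[of B] by auto
    \<comment> \<open>\<open>B\<close> itself witnesses the shift relation between its front element
      and that of \<open>behead B\<close>.\<close>
    then have "S B \<in> F" "S (behead B) \<in> F" "S B \<lhd>\<^sub>s S (behead B)"
      using S[OF B] S[of "behead B"] B(1) unfolding shift_rel_def behead_def by blast+
    then show False using F(2) le unfolding bad_def by blast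
  qed
  then show ?thesis
    using assms partial_order_on_mset_proj unfolding bpo_def by blast
qed

end
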